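(* Let $\mathtt r\le \mathtt r_0$ and suppose that the following two conditions hold for this $\mathtt r$. (i) There is a constant $\omega(\mathtt r)\in[0,1/2]$ such that for all $\theta\in\Theta_0(\mathtt r)$ and all $|\lambda|\le \mathtt g$, $$\sup_{\gamma\in\mathbb R^p\setminus\{0\}}\log \mathbb E\exp\Big\{\lambda\,\frac{\gamma^\top\{\nabla\zeta(\theta)-\nabla\zeta(\theta^* )\}}{\omega(\mathtt r)\,\|V_0\gamma\|}\Big\}\le \frac{\nu_0^2\lambda^2}{2}.$$ (ii) There are a symmetric strictly positive-definite matrix $D_0^2$ and a constant $\delta(\mathtt r)\in[0,1/2]$ such that for all $\theta\in\Theta_0(\mathtt r)$, $\theta\neq\theta^*$, $$\Big|\frac{-2\,\mathbb E L(\theta,\theta^* )}{\|D_0(\theta-\theta^* )\|^2}-1\Big|\le\delta(\mathtt r).$$ Let $\varrho\ge 3\nu_0\,\omega(\mathtt r)$ and $\delta\ge\delta(\mathtt r)$ be such that $D_\epsilon^2=D_0^2(1-\delta)-\varrho V_0^2$ is positive definite, $\epsilon=(\delta,\varrho)$. For $\mathfrak z>0$ let $$\mathcal E(\mathfrak z)=\{\theta\in\Theta:\ 2L(\tilde\theta,\theta)\le\mathfrak z\}.$$ Then for any $\mathfrak z>0$ $$\mathbb P\{\mathcal E(\mathfrak z)\not\ni\theta^*,\ \tilde\theta\in\Theta_0(\mathtt r)\}\le\mathbb P\{\|\xi_\epsilon\|^2\ge\mathfrak z-2\Diamond_\epsilon(\mathtt r)\}.$$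
   Context: Setting. $\Theta\subseteq\mathbb R^p$. The data $Y$ have a distribution $\mathbb P$ with expectation $\mathbb E$. $L(\theta)=L(Y,\theta)$, $\theta\in\Theta$, is a random function (a quasi log-likelihood; $\mathbb P$ need not belong to any parametric family). Put $L(\theta,\theta')=L(\theta)-L(\theta')$. The quasi maximum likelihood estimator $\tilde\theta=\arg\max_{\theta\in\Theta}L(\theta)$ is assumed to exist (the maximum is attained; if not unique, $\tilde\theta$ is any maximizer). The target is $\theta^*=\arg\max_{\theta\in\Theta}\mathbb E L(\theta)$, and $\nabla\mathbb E L(\theta^* )=0$. The stochastic component $\zeta(\theta)=L(\theta)-\mathbb E L(\theta)$ is differentiable in $\theta$; thus $\nabla L(\theta^* )=\nabla\zeta(\theta^* )$. $V_0^2$ is a symmetric positive-definite $p\times p$ matrix (with symmetric root $V_0$), $\mathtt g>0$, $\nu_0\ge1$ and $\mathtt r_0>0$ are constants. The local set is $\Theta_0(\mathtt r)=\{\theta:\|V_0(\theta-\theta^* )\|\le \mathtt r\}$, a full ellipsoid contained in $\Theta$ for $\mathtt r\le\mathtt r_0$. When $\omega(\mathtt r)=0$, condition (i) means $\nabla\zeta(\theta)=\nabla\zeta(\theta^* )$ on $\Theta_0(\mathtt r)$. $\xi_\epsilon=D_\epsilon^{-1}\nabla L(\theta^* )$, and $$\Diamond_{\epsilon}(\mathtt r)=\sup_{\theta\in\Theta_0(\mathtt r)}\Big\{\zeta(\theta)-\zeta(\theta^* )-(\theta-\theta^* )^\top\nabla\zeta(\theta^* )-\tfrac{\varrho}{2}\|V_0(\theta-\theta^*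 )\|^2\Big\}.$$ *)

theory Defs
  imports "HOL-Probability.Probability"
begin

definition pos_def :: "real ^ 'p ^ 'p \<Rightarrow> bool" where
  "pos_def A \<longleftrightarrow> transpose A = A \<and> (\<forall>x. x \<noteq> 0 \<longrightarrow> x \<bullet> (A *v x) > 0)"

(* For positive definite A, neither |B x| nor |matrix_inv B x| depends on the choice of B. *)
definition sym_root :: "real ^ 'p ^ 'p \<Rightarrow> real ^ 'p ^ 'p \<Rightarrow> bool" where
  "sym_root B A \<longleftrightarrow> transpose B = B \<and> B ** B = A"

(* Relative to S, because S need not be open and f carries no information off S.  At points of a
   full-dimensional ellipsoid contained in S, boundary points included, the gradient of a
   differentiable f is unique, so the choice operator is harmless there. *)
definition grad :: "(real ^ 'p) set \<Rightarrow> (real ^ 'p \<Rightarrow> real) \<Rightarrow> real ^ 'p \<Rightarrow> real ^ 'p" where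
  "grad S f x = (SOME g. (f has_derivative (\<lambda>h. g \<bullet> h)) (at x within S))"

(* Logarithm on [0, \<infinity>], so that the log of an infinite exponential moment is \<infinity>. *)
definition ln_ennreal :: "ennreal \<Rightarrow> ereal" where
  "ln_ennreal x = (if x = 0 then - \<infinity> else if x = \<infinity> then \<infinity> else ereal (ln (enn2real x)))"

(* P is the law of the data on the sample space 'y, and L y \<theta> is the quasi log-likelihood at data y. *)
definition mean_L :: "'y measure \<Rightarrow> ('y \<Rightarrow> real ^ 'p \<Rightarrow> real) \<Rightarrow> real ^ 'p \<Rightarrow> real" where
  "mean_L P L \<theta> = (\<integral>y. L y \<theta> \<partial>P)"

definition zeta :: "'y measure \<Rightarrow> ('y \<Rightarrow> real ^ 'p \<Rightarrow> real) \<Rightarrow> 'y \<Rightarrow> real ^ 'p \<Rightarrow> real" where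
  "zeta P L y \<theta> = L y \<theta> - mean_L P L \<theta>"

definition local_set :: "real ^ 'p ^ 'p \<Rightarrow> real ^ 'p \<Rightarrow> real \<Rightarrow> (real ^ 'p) set" where
  "local_set V0 \<theta>s r = {\<theta>. norm (V0 *v (\<theta> - \<theta>s)) \<le> r}"

(* For \<omega> = 0 the quotient below would be 0 in HOL; the condition then reads as equality of the
   two gradients, almost surely for each \<theta>. *)
definition grad_exp_moment ::
  "'y measure \<Rightarrow> (real ^ 'p) set \<Rightarrow> ('y \<Rightarrow> real ^ 'p \<Rightarrow> real) \<Rightarrow> real ^ 'p \<Rightarrow> real ^ 'p ^ 'p
     \<Rightarrow> real \<Rightarrow> real \<Rightarrow> real \<Rightarrow> real \<Rightarrow> bool" where
  "grad_exp_moment P \<Theta> L \<theta>s V0 g \<nu>0 r \<omega> \<longleftrightarrow>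
     (if \<omega> = 0 then
        (\<forall>\<theta>\<in>local_set V0 \<theta>s r. AE y in P. grad \<Theta> (zeta P L y) \<theta> = grad \<Theta> (zeta P L y) \<theta>s)
      else
        (\<forall>\<theta>\<in>local_set V0 \<theta>s r. \<forall>t. \<bar>t\<bar> \<le> g \<longrightarrow>
           (SUP \<gamma>\<in>UNIV - {0}. ln_ennreal (\<integral>\<^sup>+ y. ennreal (exp (t *
               ((\<gamma> \<bullet> (grad \<Theta> (zeta P L y) \<theta> - grad \<Theta> (zeta P L y) \<theta>s))
                  / (\<omega> * norm (V0 *v \<gamma>))))) \<partial>P))
           \<le> ereal (\<nu>0\<^sup>2 * t\<^sup>2 / 2)))"

definition spread ::
  "'y measure \<Rightarrow> (real ^ 'p) set \<Rightarrow> ('y \<Rightarrow> real ^ 'p \<Rightarrow> real) \<Rightarrow> real ^ 'p \<Rightarrow> real ^ 'p ^ 'p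
     \<Rightarrow> real \<Rightarrow> real \<Rightarrow> 'y \<Rightarrow> real" where
  "spread P \<Theta> L \<theta>s V0 \<rho> r y =
     (SUP \<theta>\<in>local_set V0 \<theta>s r.
        zeta P L y \<theta> - zeta P L y \<theta>s - (\<theta> - \<theta>s) \<bullet> grad \<Theta> (zeta P L y) \<theta>s
          - \<rho> / 2 * (norm (V0 *v (\<theta> - \<theta>s)))\<^sup>2)"

definition score ::
  "(real ^ 'p) set \<Rightarrow> ('y \<Rightarrow> real ^ 'p \<Rightarrow> real) \<Rightarrow> real ^ 'p \<Rightarrow> real ^ 'p ^ 'p \<Rightarrow> 'y \<Rightarrow> real ^ 'p" where
  "score \<Theta> L \<theta>s D y = matrix_inv D *v grad \<Theta> (L y) \<theta>s"

definition conf_set ::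
  "(real ^ 'p) set \<Rightarrow> ('y \<Rightarrow> real ^ 'p \<Rightarrow> real) \<Rightarrow> ('y \<Rightarrow> real ^ 'p) \<Rightarrow> real \<Rightarrow> 'y \<Rightarrow> (real ^ 'p) set" where
  "conf_set \<Theta> L \<theta>t z y = {\<theta> \<in> \<Theta>. 2 * (L y (\<theta>t y) - L y \<theta>) \<le> z}"

end

theory Submission
  imports Defs
begin

text \<open>
  The inequality of events holds for each data point \<open>y\<close> separately. Put \<open>u = \<theta>t y - \<theta>s\<close>. If the
  estimator falls into the local ellipsoid, then \<open>2 L(\<theta>t, \<theta>s)\<close> splits into twice the deterministic
  part, which the quadratic approximation of the mean bounds by \<open>-(1 - \<delta>) |D0 u|\<^sup>2\<close>, and twice the
  increment of \<open>\<zeta>\<close>, which the definition of the spread bounds by \<open>2 u \<bullet> \<nabla>\<zeta>(\<theta>s) + \<rho> |V0 u|\<^sup>2\<close> plus twice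
  the spread. The two quadratic forms combine into \<open>-|Deps u|\<^sup>2\<close>, and completing the square in
  \<open>2 u \<bullet> \<nabla>\<zeta>(\<theta>s) - |Deps u|\<^sup>2\<close> gives at most \<open>|Deps\<^sup>-\<^sup>1 \<nabla>\<zeta>(\<theta>s)|\<^sup>2 = |\<xi>|\<^sup>2\<close>, because \<open>\<nabla>\<zeta>(\<theta>s) = \<nabla>L(\<theta>s)\<close>
  (lemmas \<open>complete_square_sym_root\<close> and \<open>grad_add_stationary\<close>).
  So \<open>z < 2 L(\<theta>t, \<theta>s)\<close> forces \<open>z - 2 spread \<le> |\<xi>|\<^sup>2\<close>.

  What remains is that the larger event is measurable, without which its formal probability would
  be 0 and monotonicity could fail. The score is a limit of difference quotients
  along a sequence (lemma \<open>borel_measurable_grad\<close>), and the spread is a supremum of a continuous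
  function over a compact set, hence a supremum over a countable dense subset (lemma
  \<open>borel_measurable_SUP_compact\<close>). The smaller event, which involves an arbitrary
  selection \<open>\<theta>t\<close> of maximizers, may be non-measurable; its formal probability is then 0.
\<close>

section \<open>Symmetric roots of positive definite matrices\<close>

lemma symmetric_matrix_inner:
  fixes B :: "real ^ 'p ^ 'p"
  assumes "transpose B = B"
  shows "(B *v x) \<bullet> y = x \<bullet> (B *v y)"
proof -
  have "(B *v x) \<bullet> y = (x v* transpose B) \<bullet> y"
    by (simp only: vector_transpose_matrix)
  also have "\<dots> = x \<bullet> (B *v y)"
    by (simp only: assms dot_lmul_matrix)
  finally show ?thesis .
qed

lemma sym_root_norm_sq:
  fixes A B :: "real ^ 'p ^ 'p"
  assumes "sym_root B A"
  shows "(norm (B *v x))\<^sup>2 = x \<bullet> (A *v x)"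
proof -
  have sym: "transpose B = B" and sq: "B ** B = A"
    using assms by (simp_all only: sym_root_def)
  have "(norm (B *v x))\<^sup>2 = x \<bullet> (B *v (B *v x))"
    by (simp only: power2_norm_eq_inner symmetric_matrix_inner[OF sym])
  also have "\<dots> = x \<bullet> (A *v x)"
    by (simp only: matrix_vector_mul_assoc sq)
  finally show ?thesis .
qed

lemma pos_def_root_eq_0:
  fixes A B :: "real ^ 'p ^ 'p"
  assumes "pos_def A" "sym_root B A" "B *v x = 0"
  shows "x = 0"
proof (rule ccontr)
  assume "x \<noteq> 0"
  then have "x \<bullet> (A *v x) > 0"
    using assms(1) unfolding pos_def_def by blast
  then show False
    using sym_root_norm_sq[OF assms(2), of x] assms(3) by simp
qed

lemma pos_def_root_mult_inv:
  fixes A B :: "real ^ 'p ^ 'p"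
  assumes "pos_def A" "sym_root B A"
  shows "B *v (matrix_inv B *v x) = x"
proof -
  have "\<exists>C. C ** B = mat 1"
    using pos_def_root_eq_0[OF assms] by (simp add: matrix_left_invertible_ker)
  then have "invertible B"
    by (simp add: invertible_left_inverse)
  then have "B ** matrix_inv B = mat 1"
    unfolding invertible_def matrix_inv_def by (rule someI2_ex) simp
  then show ?thesis
    by (simp add: matrix_vector_mul_assoc)
qed

text \<open>
  The left side minus the right side is \<open>-|B u - B\<^sup>-\<^sup>1 v|\<^sup>2\<close>, since the symmetry of \<open>B\<close> gives
  \<open>u \<bullet> v = B u \<bullet> B\<^sup>-\<^sup>1 v\<close>.
\<close>

lemma complete_square_sym_root:
  fixes A B :: "real ^ 'p ^ 'p"
  assumes "pos_def A" "sym_root B A"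
  shows "2 * (u \<bullet> v) - u \<bullet> (A *v u) \<le> (norm (matrix_inv B *v v))\<^sup>2"
proof -
  define w where "w = matrix_inv B *v v"
  have "v = B *v w"
    by (simp add: w_def pos_def_root_mult_inv[OF assms])
  moreover have "transpose B = B"
    using assms(2) unfolding sym_root_def by blast
  ultimately have uv: "u \<bullet> v = (B *v u) \<bullet> w"
    by (simp only: symmetric_matrix_inner)
  have "0 \<le> (norm (B *v u - w))\<^sup>2"
    by simp
  also have "\<dots> = (norm (B *v u))\<^sup>2 - 2 * ((B *v u) \<bullet> w) + (norm w)\<^sup>2"
    unfolding power2_norm_eq_inner
    by (simp add: inner_diff_left inner_diff_right inner_commute)
  finally show ?thesis
    unfolding w_def[symmetric] uv sym_root_norm_sq[OF assms(2), symmetric] by linarith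
qed

section \<open>The local ellipsoid\<close>

lemma continuous_on_matrix_vector_mult [continuous_intros]:
  fixes A :: "real ^ 'n ^ 'm" and f :: "'a::euclidean_space \<Rightarrow> real ^ 'n"
  assumes "continuous_on S f"
  shows "continuous_on S (\<lambda>x. A *v f x)"
  by (rule linear_continuous_on_compose[OF assms matrix_vector_mul_linear])

text \<open>
  Compactness makes the supremum in the spread finite: on real sets that are unbounded above,
  \<open>SUP\<close> does not bound anything.
\<close>

lemma compact_local_set:
  fixes A V :: "real ^ 'p ^ 'p"
  assumes "pos_def A" "sym_root V A"
  shows "compact (local_set V c r)"
proof -
  have "inj (\<lambda>x. V *v x)"
    using pos_def_root_eq_0[OF assms] by (simp add: vec.inj_iff_eq_0)
  then obtain b where b: "b > 0" "\<And>x. b * norm x \<le> norm (V *v x)"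
    using linear_inj_bounded_below_pos[of "\<lambda>x. V *v x"] by (metis matrix_vector_mul_linear)
  have "local_set V c r \<subseteq> cball c (r / b)"
  proof
    fix x assume "x \<in> local_set V c r"
    then have "b * norm (x - c) \<le> r"
      using b(2)[of "x - c"] by (simp add: local_set_def)
    then show "x \<in> cball c (r / b)"
      using b(1) by (simp add: dist_norm norm_minus_commute pos_le_divide_eq mult.commute)
  qed
  then have "bounded (local_set V c r)"
    using bounded_subset bounded_cball by blast
  moreover have "closed (local_set V c r)"
    unfolding local_set_def
    by (intro closed_Collect_le continuous_intros)
  ultimately show ?thesis
    by (simp add: compact_eq_bounded_closed)
qed

lemma center_interior_local_set:
  fixes V :: "real ^ 'p ^ 'p"
  assumes "r > 0"
  shows "c \<in> interior (local_set V c r)"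
proof (rule interiorI)
  show "open {x. norm (V *v (x - c)) < r}"
    by (intro open_Collect_less continuous_intros)
qed (use assms in \<open>auto simp: local_set_def\<close>)

section \<open>Gradients at interior points\<close>

lemma grad_has_derivative:
  fixes f :: "real ^ 'p \<Rightarrow> real"
  assumes "f differentiable (at x within S)"
  shows "(f has_derivative (\<lambda>h. grad S f x \<bullet> h)) (at x within S)"
proof -
  obtain f' where f': "(f has_derivative f') (at x within S)"
    using assms by (auto simp: differentiable_def)
  define v where "v = adjoint f' 1"
  have "h \<bullet> v = f' h" for h
    unfolding v_def adjoint_works[OF has_derivative_linear[OF f']] by simp
  then have "f' = (\<lambda>h. v \<bullet> h)"
    by (simp add: fun_eq_iff inner_commute)
  with f' have "\<exists>g. (f has_derivative (\<lambda>h. g \<bullet> h)) (at x within S)"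
    by (intro exI[of _ v]) simp
  from someI_ex[OF this] show ?thesis
    by (simp only: grad_def)
qed

text \<open>
  At an interior point the derivative within \<open>S\<close> is the full derivative, which is unique, so the
  choice in the definition of \<open>grad\<close> has only one candidate.
\<close>

lemma grad_eqI:
  fixes f :: "real ^ 'p \<Rightarrow> real"
  assumes "x \<in> interior S" "(f has_derivative (\<lambda>h. v \<bullet> h)) (at x)"
  shows "grad S f x = v"
proof -
  have "(f has_derivative (\<lambda>h. grad S f x \<bullet> h)) (at x)"
    using grad_has_derivative[of f x S] differentiableI[OF assms(2)]
    by (simp only: at_within_interior[OF assms(1)])
  then have "(\<lambda>h. grad S f x \<bullet> h) = (\<lambda>h. v \<bullet> h)"
    using assms(2) by (rule has_derivative_unique)
  then have "\<forall>h. grad S f x \<bullet> h = v \<bullet> h"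
    by (simp add: fun_eq_iff)
  then show ?thesis
    by (simp only: vector_eq_rdot)
qed

text \<open>
  Applied to \<open>L = \<zeta> + E L\<close> at the stationary point \<open>\<theta>s\<close> of the mean, this identifies the gradient
  in the score with the gradient in the spread.
\<close>

lemma grad_add_stationary:
  fixes f m :: "real ^ 'p \<Rightarrow> real"
  assumes "x \<in> interior S" "f differentiable (at x)" "GDERIV m x :> 0"
  shows "grad S (\<lambda>x. f x + m x) x = grad S f x"
proof (rule grad_eqI[OF assms(1)])
  have "(f has_derivative (\<lambda>h. grad S f x \<bullet> h)) (at x)"
    using grad_has_derivative[of f x S] assms(2) by (simp only: at_within_interior[OF assms(1)])
  moreover have "(m has_derivative (\<lambda>h. 0)) (at x)"
    using assms(3) by (simp add: gderiv_def)
  ultimately have "((\<lambda>x. f x + m x) has_derivative (\<lambda>h. grad S f x \<bullet> h + 0)) (at x)"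
    by (rule has_derivative_add)
  then show "((\<lambda>x. f x + m x) has_derivative (\<lambda>h. grad S f x \<bullet> h)) (at x)"
    by simp
qed

section \<open>Measurability\<close>

text \<open>
  Each coordinate of the gradient is the limit of the difference quotients with steps
  \<open>e / (n + 1)\<close>, where \<open>e\<close> is so small that all the evaluation points stay in \<open>S\<close>.
\<close>

lemma borel_measurable_grad:
  fixes f :: "'y \<Rightarrow> real ^ 'p \<Rightarrow> real"
  assumes x: "x \<in> interior S"
    and meas: "\<And>t. t \<in> S \<Longrightarrow> (\<lambda>y. f y t) \<in> borel_measurable M"
    and diff: "\<And>y. y \<in> space M \<Longrightarrow> f y differentiable (at x)"
  shows "(\<lambda>y. grad S (f y) x) \<in> borel_measurable M"
proof (subst borel_measurable_euclidean_space, rule ballI)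
  fix b :: "real ^ 'p" assume b: "b \<in> Basis"
  obtain e where e: "e > 0" "cball x e \<subseteq> S"
    using x by (auto simp: mem_interior_cball)
  define h where "h n = e / real (Suc n)" for n
  have h: "h n > 0" "h n \<le> e" for n
    using e(1) by (auto simp: h_def field_simps)
  have h_nz: "h n \<noteq> 0" for n
    using h(1)[of n] by simp
  have xh: "x + h n *\<^sub>R b \<in> S" for n
    using e(2) h[of n] b by (auto simp: dist_norm subset_eq)
  have "x \<in> S"
    using x interior_subset by blast
  have h0: "h \<longlonglongrightarrow> 0"
    unfolding h_def by (rule LIMSEQ_Suc[OF lim_const_over_n])
  show "(\<lambda>y. grad S (f y) x \<bullet> b) \<in> borel_measurable M"
  proof (rule borel_measurable_LIMSEQ_real)
    fix y assume y: "y \<in> space M"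
    have "(f y has_derivative (\<lambda>v. grad S (f y) x \<bullet> v)) (at x)"
      using grad_has_derivative[of "f y" x S] diff[OF y] by (simp only: at_within_interior[OF x])
    then have "(f y has_derivative (\<lambda>v. grad S (f y) x \<bullet> v)) (at (x + 0 *\<^sub>R b))"
      by simp
    moreover have "((\<lambda>s. x + s *\<^sub>R b) has_derivative (\<lambda>s. s *\<^sub>R b)) (at 0)"
      by (auto intro!: derivative_eq_intros)
    ultimately have "((\<lambda>s. f y (x + s *\<^sub>R b)) has_derivative
        (\<lambda>s. grad S (f y) x \<bullet> (s *\<^sub>R b))) (at 0)"
      by (rule has_derivative_compose[rotated])
    moreover have "(\<lambda>s. grad S (f y) x \<bullet> (s *\<^sub>R b)) = (*) (grad S (f y) x \<bullet> b)"
      by (simp add: fun_eq_iff)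
    ultimately have "((\<lambda>s. f y (x + s *\<^sub>R b)) has_real_derivative grad S (f y) x \<bullet> b) (at 0)"
      by (simp only: has_field_derivative_def)
    then have "((\<lambda>s. (f y (x + s *\<^sub>R b) - f y x) / s) \<longlongrightarrow> grad S (f y) x \<bullet> b) (at 0)"
      unfolding has_field_derivative_iff by simp
    moreover have "filterlim h (at 0) sequentially"
      using h0 h_nz by (simp add: filterlim_at)
    ultimately show "(\<lambda>n. (f y (x + h n *\<^sub>R b) - f y x) / h n) \<longlonglongrightarrow> grad S (f y) x \<bullet> b"
      by (rule filterlim_compose)
  next
    fix n
    show "(\<lambda>y. (f y (x + h n *\<^sub>R b) - f y x) / h n) \<in> borel_measurable M"
      using meas[OF xh] meas[OF \<open>x \<in> S\<close>] by simp
  qed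
qed

text \<open>Continuity makes the supremum equal to the supremum over a countable dense subset.\<close>

lemma borel_measurable_SUP_compact:
  fixes f :: "'y \<Rightarrow> 'a::{metric_space, second_countable_topology} \<Rightarrow> real"
  assumes K: "compact K" "K \<noteq> {}"
    and cont: "\<And>y. y \<in> space M \<Longrightarrow> continuous_on K (f y)"
    and meas: "\<And>t. t \<in> K \<Longrightarrow> (\<lambda>y. f y t) \<in> borel_measurable M"
  shows "(\<lambda>y. SUP t\<in>K. f y t) \<in> borel_measurable M"
proof -
  obtain T where T: "countable T" "T \<subseteq> K" "K \<subseteq> closure T"
    by (rule separable)
  have cl: "closure T = K"
    using T K(1) by (simp add: closure_minimal compact_imp_closed subset_antisym)
  then have "T \<noteq> {}"
    using K(2) by auto
  have bdd: "bdd_above (f y ` K)" if "y \<in> space M" for y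
    by (rule bounded_imp_bdd_above[OF compact_imp_bounded[OF compact_continuous_image[OF cont[OF that] K(1)]]])
  have bddT: "bdd_above (f y ` T)" if "y \<in> space M" for y
    by (rule bdd_above_mono[OF bdd[OF that] image_mono[OF T(2)]])
  have eq: "(SUP t\<in>K. f y t) = (SUP t\<in>T. f y t)" if y: "y \<in> space M" for y
  proof (rule antisym)
    show "(SUP t\<in>T. f y t) \<le> (SUP t\<in>K. f y t)"
      by (rule cSUP_subset_mono[OF \<open>T \<noteq> {}\<close> bdd[OF y] T(2) order_refl])
    show "(SUP t\<in>K. f y t) \<le> (SUP t\<in>T. f y t)"
    proof (rule cSUP_least[OF K(2)])
      fix t assume "t \<in> K"
      then have "t \<in> closure T"
        using T(3) by blast
      moreover have "continuous_on (closure T) (f y)"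
        unfolding cl by (rule cont[OF y])
      ultimately show "f y t \<le> (SUP t\<in>T. f y t)"
        using continuous_le_on_closure cSUP_upper[OF _ bddT[OF y]] by metis
    qed
  qed
  have "(\<lambda>y. SUP t\<in>T. f y t) \<in> borel_measurable M"
    using T(2) meas by (intro borel_measurable_cSUP T(1) bddT) blast+
  then show ?thesis
    by (simp only: measurable_cong[OF eq])
qed

section \<open>The confidence bound\<close>

theorem corollary3p2:
  fixes P :: "'y measure"
    and \<Theta> :: "(real ^ 'p) set"
    and L :: "'y \<Rightarrow> real ^ 'p \<Rightarrow> real"
    and \<theta>t :: "'y \<Rightarrow> real ^ 'p"
    and \<theta>s :: "real ^ 'p"
    and V0 V0sq D0 D0sq Deps :: "real ^ 'p ^ 'p"
    and g \<nu>0 r0 r \<omega> \<delta>r \<delta> \<rho> z :: real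
  assumes "prob_space P"
    and "\<And>\<theta>. \<theta> \<in> \<Theta> \<Longrightarrow> integrable P (\<lambda>y. L y \<theta>)"
    and "\<And>y. y \<in> space P \<Longrightarrow> is_arg_max (L y) (\<lambda>\<theta>. \<theta> \<in> \<Theta>) (\<theta>t y)"
    and "is_arg_max (mean_L P L) (\<lambda>\<theta>. \<theta> \<in> \<Theta>) \<theta>s"
    and "GDERIV (mean_L P L) \<theta>s :> 0"
    and "\<And>y. y \<in> space P \<Longrightarrow> zeta P L y differentiable_on \<Theta>"
    and "pos_def V0sq" and "sym_root V0 V0sq"
    and "g > 0" and "\<nu>0 \<ge> 1" and "r0 > 0"
    and "\<And>s. s \<le> r0 \<Longrightarrow> local_set V0 \<theta>s s \<subseteq> \<Theta>"
    and "r \<le> r0"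
    and "0 \<le> \<omega>" and "\<omega> \<le> 1 / 2"
    and "grad_exp_moment P \<Theta> L \<theta>s V0 g \<nu>0 r \<omega>"
    and "pos_def D0sq" and "sym_root D0 D0sq"
    and "0 \<le> \<delta>r" and "\<delta>r \<le> 1 / 2"
    and "\<And>\<theta>. \<theta> \<in> local_set V0 \<theta>s r \<Longrightarrow> \<theta> \<noteq> \<theta>s \<Longrightarrow>
           \<bar>- 2 * (\<integral>y. L y \<theta> - L y \<theta>s \<partial>P) / (norm (D0 *v (\<theta> - \<theta>s)))\<^sup>2 - 1\<bar> \<le> \<delta>r"
    and "\<rho> \<ge> 3 * \<nu>0 * \<omega>" and "\<delta> \<ge> \<delta>r"
    and "pos_def ((1 - \<delta>) *\<^sub>R D0sq - \<rho> *\<^sub>R V0sq)"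
    and "sym_root Deps ((1 - \<delta>) *\<^sub>R D0sq - \<rho> *\<^sub>R V0sq)"
    and "z > 0"
  shows "\<P>(y in P. \<theta>s \<notin> conf_set \<Theta> L \<theta>t z y \<and> \<theta>t y \<in> local_set V0 \<theta>s r)
       \<le> \<P>(y in P. (norm (score \<Theta> L \<theta>s Deps y))\<^sup>2 \<ge> z - 2 * spread P \<Theta> L \<theta>s V0 \<rho> r y)"
proof -
  interpret prob_space P by fact
  note integrable_L = assms(2) and diff_zeta = assms(6) and V0 = assms(7,8)
    and D0 = assms(18) and Deps = assms(24,25)
  define S where "S = local_set V0 \<theta>s r"
  define Z where "Z = zeta P L"
  define G where "G y = grad \<Theta> (Z y) \<theta>s" for y
  define F where "F y \<theta> = Z y \<theta> - Z y \<theta>s - (\<theta> - \<theta>s) \<bullet> G y - \<rho> / 2 * (norm (V0 *v (\<theta> - \<theta>s)))\<^sup>2"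
    for y \<theta>
  have spread_eq: "spread P \<Theta> L \<theta>s V0 \<rho> r y = (SUP \<theta>\<in>S. F y \<theta>)" for y
    by (simp add: spread_def S_def F_def G_def Z_def)
  have S_sub: "S \<subseteq> \<Theta>"
    using assms(12,13) by (auto simp: S_def)
  have compact_S: "compact S"
    unfolding S_def by (rule compact_local_set[OF V0])
  have int: "\<theta>s \<in> interior \<Theta>"
    using center_interior_local_set[OF assms(11)] interior_mono[OF assms(12)] by blast
  then have "\<theta>s \<in> \<Theta>"
    using interior_subset by blast
  have diff_Z: "Z y differentiable (at \<theta>s)" if "y \<in> space P" for y
    using diff_zeta[OF that] \<open>\<theta>s \<in> \<Theta>\<close> at_within_interior[OF int]
    by (auto simp: Z_def differentiable_on_def)
  have meas_Z: "(\<lambda>y. Z y \<theta>) \<in> borel_measurable P" if "\<theta> \<in> \<Theta>" for \<theta>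
    using integrable_L[OF that] unfolding Z_def zeta_def by simp
  have grad_L: "grad \<Theta> (L y) \<theta>s = G y" if "y \<in> space P" for y
  proof -
    have "(\<lambda>\<theta>. Z y \<theta> + mean_L P L \<theta>) = L y"
      by (simp add: Z_def zeta_def)
    then show ?thesis
      using grad_add_stationary[OF int diff_Z[OF that] assms(5)] by (simp only: G_def)
  qed
  have cont_F: "continuous_on S (F y)" if "y \<in> space P" for y
  proof -
    have "continuous_on S (Z y)"
      unfolding Z_def
      by (rule continuous_on_subset[OF differentiable_imp_continuous_on[OF diff_zeta[OF that]] S_sub])
    then show ?thesis
      unfolding F_def
      by (intro continuous_intros)
  qed
  show ?thesis
  \<comment> \<open>For negative \<open>r\<close> the ellipsoid is empty and the spread is an unspecified constant, but then the
    smaller event is empty as well.\<close>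
  proof (cases "S = {}")
    case True
    then show ?thesis
      by (simp add: S_def)
  next
    case False
    have meas_G: "G \<in> borel_measurable P"
      unfolding G_def by (rule borel_measurable_grad[OF int meas_Z diff_Z])
    have meas_F: "(\<lambda>y. F y \<theta>) \<in> borel_measurable P" if "\<theta> \<in> S" for \<theta>
      using meas_Z[of \<theta>] meas_Z[OF \<open>\<theta>s \<in> \<Theta>\<close>] meas_G that S_sub unfolding F_def by auto
    have meas_spread: "(\<lambda>y. SUP \<theta>\<in>S. F y \<theta>) \<in> borel_measurable P"
      by (rule borel_measurable_SUP_compact[OF compact_S False cont_F meas_F])
    have meas_norm: "(\<lambda>y. (norm (matrix_inv Deps *v G y))\<^sup>2) \<in> borel_measurable P"
    proof (rule measurable_compose[OF meas_G])
      show "(\<lambda>v. (norm (matrix_inv Deps *v v))\<^sup>2) \<in> borel_measurable borel"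
        by (intro borel_measurable_continuous_onI continuous_intros)
    qed
    have "{y \<in> space P. (norm (score \<Theta> L \<theta>s Deps y))\<^sup>2 \<ge> z - 2 * spread P \<Theta> L \<theta>s V0 \<rho> r y}
        = {y \<in> space P. z - 2 * (SUP \<theta>\<in>S. F y \<theta>) \<le> (norm (matrix_inv Deps *v G y))\<^sup>2}"
      using grad_L by (auto simp: score_def spread_eq)
    also have "\<dots> \<in> sets P"
      using meas_spread meas_norm by measurable
    finally have event: "{y \<in> space P. (norm (score \<Theta> L \<theta>s Deps y))\<^sup>2
        \<ge> z - 2 * spread P \<Theta> L \<theta>s V0 \<rho> r y} \<in> sets P" .
    have key: "2 * (L y \<theta> - L y \<theta>s)
        \<le> (norm (score \<Theta> L \<theta>s Deps y))\<^sup>2 + 2 * spread P \<Theta> L \<theta>s V0 \<rho> r y"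
      if y: "y \<in> space P" and \<theta>: "\<theta> \<in> S" for y \<theta>
    proof -
      define u where "u = \<theta> - \<theta>s"
      have "2 * (mean_L P L \<theta> - mean_L P L \<theta>s) \<le> - ((1 - \<delta>) * (norm (D0 *v u))\<^sup>2)"
      proof (cases "\<theta> = \<theta>s")
        case True
        then show ?thesis
          by (simp add: u_def)
      next
        case neq: False
        have "(\<integral>y. L y \<theta> - L y \<theta>s \<partial>P) = mean_L P L \<theta> - mean_L P L \<theta>s"
          using integrable_L \<theta> S_sub \<open>\<theta>s \<in> \<Theta>\<close> by (auto simp: mean_L_def)
        then have "\<bar>- 2 * (mean_L P L \<theta> - mean_L P L \<theta>s) / (norm (D0 *v u))\<^sup>2 - 1\<bar> \<le> \<delta>r"
          using assms(21)[of \<theta>] \<theta> neq by (simp add: S_def u_def)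
        then have quot: "1 - \<delta> \<le> - 2 * (mean_L P L \<theta> - mean_L P L \<theta>s) / (norm (D0 *v u))\<^sup>2"
          using assms(23) by linarith
        have "D0 *v u \<noteq> 0"
          using pos_def_root_eq_0[OF assms(17) D0, of u] neq by (auto simp: u_def)
        then have "(norm (D0 *v u))\<^sup>2 > 0"
          by simp
        from quot[unfolded pos_le_divide_eq[OF this]] show ?thesis
          by linarith
      qed
      moreover have "F y \<theta> \<le> spread P \<Theta> L \<theta>s V0 \<rho> r y"
        unfolding spread_eq
        by (rule cSUP_upper[OF \<theta> bounded_imp_bdd_above[OF compact_imp_bounded[OF
                compact_continuous_image[OF cont_F[OF y] compact_S]]]])
      moreover have "L y \<theta> - L y \<theta>s = mean_L P L \<theta> - mean_L P L \<theta>s + (Z y \<theta> - Z y \<theta>s)"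
        by (simp add: Z_def zeta_def)
      ultimately have "2 * (L y \<theta> - L y \<theta>s) \<le> 2 * (u \<bullet> G y)
          - ((1 - \<delta>) * (norm (D0 *v u))\<^sup>2 - \<rho> * (norm (V0 *v u))\<^sup>2)
          + 2 * spread P \<Theta> L \<theta>s V0 \<rho> r y"
        by (simp add: F_def u_def algebra_simps)
      also have "(1 - \<delta>) * (norm (D0 *v u))\<^sup>2 - \<rho> * (norm (V0 *v u))\<^sup>2
          = u \<bullet> (((1 - \<delta>) *\<^sub>R D0sq - \<rho> *\<^sub>R V0sq) *v u)"
        by (simp add: sym_root_norm_sq[OF D0] sym_root_norm_sq[OF V0(2)]
            matrix_vector_mult_diff_rdistrib inner_diff_right flip: scaleR_matrix_vector_assoc)
      finally show ?thesis
        using complete_square_sym_root[OF Deps, of u "G y"] grad_L[OF y] by (simp add: score_def)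
    qed
    show ?thesis
    proof (rule finite_measure_mono[OF _ event], clarify)
      fix y assume y: "y \<in> space P" "\<theta>s \<notin> conf_set \<Theta> L \<theta>t z y" "\<theta>t y \<in> local_set V0 \<theta>s r"
      then have "z < 2 * (L y (\<theta>t y) - L y \<theta>s)"
        using \<open>\<theta>s \<in> \<Theta>\<close> by (simp add: conf_set_def)
      then show "z - 2 * spread P \<Theta> L \<theta>s V0 \<rho> r y \<le> (norm (score \<Theta> L \<theta>s Deps y))\<^sup>2"
        using key[OF y(1), of "\<theta>t y"] y(3) by (simp add: S_def)
    qed
  qed
qed

end
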